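(* Let $w\in A^+$ be primitive and let $n$ be the Nyldon word conjugate to $w$. Then there are integers $K$ and $k_0$ (depending on $w$) such that for every $k\ge k_0$ the Nyldon factorization of $w^k$ has the form $(p_1,\dots,p_i,n,n,\dots,n,s_1,\dots,s_j)$ for some $i,j\ge 0$ and Nyldon words $p_1,\dots,p_i,s_1,\dots,s_j$, where the factor $n$ appears in the displayed consecutive run $k-K$ times.
   Context: $A=\{0,1,\dots,m\}$ ($m\ge 1$) is a finite alphabet ordered $0<1<\cdots<m$. The lexicographic order $<_{\text{lex}}$ on $A^*$: $u<_{\text{lex}}v$ if $u$ is a proper prefix of $v$, or there are a word $p$ and letters $i<j$ with $pi$ a prefix of $u$ and $pj$ a prefix of $v$. Nyldon words are defined recursively: a nonempty word $w$ is Nyldon if $w$ is a single letter, or $w$ cannot be written as $w=w_1w_2\cdots w_k$ with $k\ge 2$, each $w_i$ Nyldon, and $w_1\le_{\text{lex}}w_2\le_{\text{lex}}\cdots\le_{\text{lex}}w_k$. Every nonempty word has a unique Nyldon factorization, i.e. a unique expression $w=w_1\cdots w_k$ ($k\ge1$) with the $w_i$ Nyldon and $w_1\le_{\text{lex}}\cdots\le_{\text{lex}}w_k$; every primitive word has exactly one Nyldon conjugate. A word is primitive if it is not $u^k$ for a word $u$ and $k\ge 2$; $x$ is a conjugate of $w$ if $w=uv$, $x=vu$. *)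

theory Defs
  imports Main "HOL-Library.List_Lexorder" "HOL-Library.Sublist"
begin

text \<open>
  Words are lists over a linearly ordered type; \<open>\<le>\<close> on lists is the lexicographic order of
  \<^theory>\<open>HOL-Library.List_Lexorder\<close>, in which a proper prefix is smaller.
\<close>

abbreviation word_power :: "'a list \<Rightarrow> nat \<Rightarrow> 'a list" where
  "word_power w k \<equiv> concat (replicate k w)"

definition primitive :: "'a list \<Rightarrow> bool" where
  "primitive w \<longleftrightarrow> \<not> (\<exists>u k. k \<ge> 2 \<and> w = word_power u k)"

definition conjugate :: "'a list \<Rightarrow> 'a list \<Rightarrow> bool" where
  "conjugate x w \<longleftrightarrow> (\<exists>u v. w = u @ v \<and> x = v @ u)"

text \<open>
  The conjunct \<open>[] \<notin> set ws\<close> only serves termination: it is implied by all factors being Nyldon,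
  see \<open>nyldon_iff\<close> below.
\<close>

context
  notes conj_cong [fundef_cong]
begin

function nyldon :: "'a::linorder list \<Rightarrow> bool" where
  "nyldon w \<longleftrightarrow> w \<noteq> [] \<and>
     (length w = 1 \<or>
      \<not> (\<exists>ws. (length ws \<ge> 2 \<and> concat ws = w \<and> [] \<notin> set ws) \<and>
               (\<forall>u\<in>set ws. nyldon u) \<and> sorted ws))"
  by pat_completeness auto

end

lemma length_less_length_concat:
  assumes "length ws \<ge> 2" "[] \<notin> set ws" "u \<in> set ws"
  shows "length u < length (concat ws)"
proof -
  from assms(3) obtain xs ys where ws: "ws = xs @ u # ys"
    by (auto simp: in_set_conv_decomp)
  have "concat xs \<noteq> [] \<or> concat ys \<noteq> []"
    using assms(1,2) unfolding ws by (cases xs; cases ys) auto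
  then show ?thesis unfolding ws by auto
qed

termination nyldon
proof (relation "measure length")
  fix w u :: "'a list" and ws :: "'a list list"
  assume "2 \<le> length ws \<and> concat ws = w \<and> [] \<notin> set ws" "u \<in> set ws"
  then show "(u, w) \<in> measure length"
    using length_less_length_concat[of ws u] by simp
qed simp

declare nyldon.simps [simp del]

definition is_nyldon_factorization :: "'a::linorder list \<Rightarrow> 'a list list \<Rightarrow> bool" where
  "is_nyldon_factorization w ws \<longleftrightarrow> concat ws = w \<and> (\<forall>u\<in>set ws. nyldon u) \<and> sorted ws"

definition nyldon_factorization :: "'a::linorder list \<Rightarrow> 'a list list" where
  "nyldon_factorization w = (THE ws. is_nyldon_factorization w ws)"

lemma not_nyldon_Nil [simp]: "\<not> nyldon []"
  by (subst nyldon.simps) simp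

lemma nyldon_iff:
  "nyldon w \<longleftrightarrow> w \<noteq> [] \<and>
     (length w = 1 \<or>
      \<not> (\<exists>ws. length ws \<ge> 2 \<and> concat ws = w \<and> (\<forall>u\<in>set ws. nyldon u) \<and> sorted ws))"
proof -
  have *: "(\<forall>u\<in>set ws. nyldon u) \<Longrightarrow> [] \<notin> set ws" for ws :: "'a list list"
    by auto
  show ?thesis
    by (subst nyldon.simps) (use * in blast)
qed

lemma is_nyldon_factorization_ex: "\<exists>ws. is_nyldon_factorization w ws"
proof -
  consider "w = []" | "nyldon w" | "w \<noteq> []" "\<not> nyldon w"
    by blast
  then show ?thesis
  proof cases
    case 1
    then have "is_nyldon_factorization w []" by (simp add: is_nyldon_factorization_def)
    then show ?thesis ..
  next
    case 2
    then have "is_nyldon_factorization w [w]" by (simp add: is_nyldon_factorization_def)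
    then show ?thesis ..
  next
    case 3
    then show ?thesis
      using nyldon_iff[of w] by (auto simp: is_nyldon_factorization_def)
  qed
qed

lemma nyldon_factorization_singleton:
  assumes "nyldon w" "is_nyldon_factorization w ws"
  shows "ws = [w]"
proof -
  have "w \<noteq> []" using assms(1) by auto
  have "\<not> length ws \<ge> 2"
  proof
    assume l: "length ws \<ge> 2"
    have f: "concat ws = w" "\<forall>u\<in>set ws. nyldon u" "sorted ws"
      using assms(2) by (auto simp: is_nyldon_factorization_def)
    have "[] \<notin> set ws" using f(2) by auto
    moreover have "hd ws \<in> set ws" using l by (cases ws) auto
    ultimately have "length (hd ws) < length w" "hd ws \<noteq> []"
      using length_less_length_concat[OF l, of "hd ws"] f(1) by auto
    then have "length w \<noteq> 1" by (cases "hd ws") auto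
    then show False using assms(1) f l nyldon_iff[of w] by blast
  qed
  then show ?thesis
    using assms \<open>w \<noteq> []\<close>
    by (cases ws; cases "tl ws") (auto simp: is_nyldon_factorization_def)
qed

lemma less_append_list: "v \<noteq> [] \<Longrightarrow> u < u @ (v :: 'a::linorder list)"
  by (auto simp: list_less_def lexord_append_rightI neq_Nil_conv)

lemma nyldon_suffix_aux:
  fixes w :: "'a::linorder list"
  assumes A: "\<And>w s :: 'a list. length w \<le> N \<Longrightarrow> nyldon w \<Longrightarrow> nyldon s \<Longrightarrow> strict_suffix s w \<Longrightarrow> s < w"
  assumes "length (concat ys) \<le> N" "is_nyldon_factorization w ys" "nyldon s" "suffix s w"
  shows "ys \<noteq> [] \<and> suffix s (last ys)"
  using assms(2-5)
proof (induction ys arbitrary: w)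
  case Nil
  then show ?case by (auto simp: is_nyldon_factorization_def)
next
  case (Cons y ys)
  have w: "w = y @ concat ys" and y: "nyldon y"
    and f: "is_nyldon_factorization (concat ys) ys" and le: "\<forall>u\<in>set ys. y \<le> u"
    using Cons.prems(2) by (auto simp: is_nyldon_factorization_def)
  show ?case
  proof (cases "suffix s (concat ys)")
    case True
    then show ?thesis using Cons.IH[OF _ f Cons.prems(3)] Cons.prems(1) by auto
  next
    case False
    moreover have "suffix s (y @ concat ys)" using Cons.prems(4) unfolding w .
    ultimately obtain t where t: "s = t @ concat ys" "suffix t y"
      unfolding suffix_append by blast
    have "t \<noteq> []" using False t(1) by auto
    note t = t this
    show ?thesis
    proof (cases "ys = []")
      case True
      then show ?thesis using t by simp
    next
      case ne: False
      obtain zs where zs: "is_nyldon_factorization t zs"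
        using is_nyldon_factorization_ex by blast
      have "zs \<noteq> []" using zs t(3) by (auto simp: is_nyldon_factorization_def)
      have last: "nyldon (last zs)" "suffix (last zs) t"
      proof -
        show "nyldon (last zs)"
          using zs \<open>zs \<noteq> []\<close> by (simp add: is_nyldon_factorization_def)
        have "t = concat (butlast zs) @ last zs"
          using zs \<open>zs \<noteq> []\<close> append_butlast_last_id[of zs]
          by (metis concat.simps concat_append append_Nil2 is_nyldon_factorization_def)
        then show "suffix (last zs) t" by (auto simp: suffix_def)
      qed
      have "suffix (last zs) y" using last(2) t(2) by (rule suffix_order.trans)
      then have "last zs \<le> y"
        using A[of y "last zs"] Cons.prems(1) y last(1)
        by (cases "last zs = y") (auto simp: strict_suffix_def intro: less_imp_le)
      moreover have "\<forall>z\<in>set zs. z \<le> last zs"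
      proof -
        have "sorted (butlast zs @ [last zs])"
          using zs \<open>zs \<noteq> []\<close> by (simp add: is_nyldon_factorization_def)
        then have "\<forall>z\<in>set (butlast zs @ [last zs]). z \<le> last zs"
          by (auto simp: sorted_append)
        then show ?thesis using \<open>zs \<noteq> []\<close> by simp
      qed
      ultimately have "sorted (zs @ ys)"
        using le zs f
        by (fastforce simp: sorted_append is_nyldon_factorization_def)
      then have "is_nyldon_factorization s (zs @ ys)"
        using zs f t(1) by (auto simp: is_nyldon_factorization_def)
      then have "zs @ ys = [s]"
        using nyldon_factorization_singleton Cons.prems(3) by blast
      then show ?thesis using ne \<open>zs \<noteq> []\<close> by (cases zs) auto
    qed
  qed
qed

lemma nyldon_suffix_less:
  fixes w s :: "'a::linorder list"
  assumes "nyldon w" "nyldon s" "strict_suffix s w"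
  shows "s < w"
  using assms
proof (induction "length w" arbitrary: w s rule: less_induct)
  case (less w)
  note outer = less.hyps
  from less.prems show ?case
  proof (induction "length w - length s" arbitrary: s rule: less_induct)
    case (less s)
    from less.prems(3) obtain x where x: "w = x @ s" "x \<noteq> []"
      by (auto simp: strict_suffix_def suffix_def)
    obtain xs where xs: "is_nyldon_factorization x xs"
      using is_nyldon_factorization_ex by blast
    then have "xs \<noteq> []" using x(2) by (auto simp: is_nyldon_factorization_def)
    define b where "b = last xs"
    define us where "us = butlast xs"
    have xs_eq: "xs = us @ [b]" using \<open>xs \<noteq> []\<close> by (simp add: b_def us_def)
    have b: "nyldon b" using xs by (simp add: xs_eq is_nyldon_factorization_def)
    have x_eq: "x = concat us @ b" using xs by (simp add: xs_eq is_nyldon_factorization_def)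
    have "s < b"
    proof (rule ccontr)
      assume "\<not> s < b"
      then have "b \<le> s" by simp
      then have "is_nyldon_factorization w (xs @ [s])"
        using xs x(1) less.prems(2)
        by (force simp: xs_eq is_nyldon_factorization_def sorted_append)
      then show False
        using nyldon_factorization_singleton[OF less.prems(1)] \<open>xs \<noteq> []\<close> by fastforce
    qed
    moreover have "s \<noteq> []" using less.prems(2) by auto
    ultimately have sb: "s < b @ s" using less_append_list less_trans by blast
    show ?case
    proof (cases "us = []")
      case True
      then show ?thesis using sb x(1) x_eq by simp
    next
      case False
      have "[] \<notin> set xs" using xs by (auto simp: is_nyldon_factorization_def)
      then have "concat us \<noteq> []" using False xs_eq by (cases us) auto
      then have len: "length (b @ s) < length w" using x(1) x_eq by simp
      obtain ys where ys: "is_nyldon_factorization (b @ s) ys"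
        using is_nyldon_factorization_ex by blast
      have cys: "concat ys = b @ s" using ys by (simp add: is_nyldon_factorization_def)
      have "ys \<noteq> [] \<and> suffix s (last ys)"
        by (rule nyldon_suffix_aux[where N = "length (b @ s)", OF _ _ ys less.prems(2)])
           (use outer len cys in \<open>auto simp: suffix_def\<close>)
      then have yne: "ys \<noteq> []" and sl: "suffix s (last ys)" by auto
      define y where "y = last ys"
      define vs where "vs = butlast ys"
      have ys_eq: "ys = vs @ [y]" using yne by (simp add: y_def vs_def)
      have y: "nyldon y" using ys by (simp add: ys_eq is_nyldon_factorization_def)
      have bs: "b @ s = concat vs @ y" using cys ys_eq by simp
      have "length y < length w" using arg_cong[OF bs, of length] len by simp
      have "w = concat us @ concat vs @ y" using x(1) x_eq bs by simp
      then have yw: "strict_suffix y w"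
        using \<open>length y < length w\<close> by (auto simp: strict_suffix_def suffix_def)
      show ?thesis
      proof (cases "y = s")
        case True
        then have "b = concat vs" using bs by simp
        then have "is_nyldon_factorization b vs"
          using ys by (simp add: ys_eq is_nyldon_factorization_def sorted_append)
        then have "vs = [b]" using b nyldon_factorization_singleton by blast
        then have "b \<le> s" using ys True by (simp add: ys_eq is_nyldon_factorization_def)
        then show ?thesis using \<open>s < b\<close> by simp
      next
        case False
        then have sy: "strict_suffix s y" using sl by (simp add: y_def strict_suffix_def)
        then have "length s < length y" by (rule suffix_length_less)
        then have "length w - length y < length w - length s"
          using \<open>length y < length w\<close> by simp
        then have "y < w" using less.hyps less.prems(1) y yw by blast
        moreover have "s < y"
          using outer[OF \<open>length y < length w\<close> y less.prems(2) sy] .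
        ultimately show ?thesis by simp
      qed
    qed
  qed
qed

lemma is_nyldon_factorization_unique:
  assumes "is_nyldon_factorization w xs" "is_nyldon_factorization w ys"
  shows "xs = ys"
  using assms
proof (induction xs arbitrary: w ys rule: rev_induct)
  case Nil
  then show ?case by (cases ys) (auto simp: is_nyldon_factorization_def)
next
  case (snoc x xs)
  have suf: "zs \<noteq> [] \<and> suffix s (last zs)"
    if "is_nyldon_factorization w zs" "nyldon s" "suffix s w" for zs s
    using nyldon_suffix_aux[OF _ order_refl that] nyldon_suffix_less by blast
  have x: "nyldon x" "suffix x w" "w = concat xs @ x" "is_nyldon_factorization (concat xs) xs"
    using snoc.prems(1) by (auto simp: is_nyldon_factorization_def suffix_def sorted_append)
  have *: "ys \<noteq> []" "suffix x (last ys)" using suf[OF snoc.prems(2) x(1,2)] by auto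
  then obtain vs y where ys: "ys = vs @ [y]" by (metis append_butlast_last_id)
  have y: "nyldon y" "suffix y w" "w = concat vs @ y" "is_nyldon_factorization (concat vs) vs"
    using snoc.prems(2) ys by (auto simp: is_nyldon_factorization_def suffix_def sorted_append)
  have "suffix y x" using suf[OF snoc.prems(1) y(1,2)] by simp
  then have "x = y" using * ys by (simp add: suffix_order.antisym)
  then have "concat vs = concat xs" using x(3) y(3) by (metis append_same_eq)
  then have "xs = vs" using snoc.IH[OF x(4)] y(4) by metis
  then show ?case using \<open>x = y\<close> ys by blast
qed

lemma ex1_is_nyldon_factorization: "\<exists>!ws. is_nyldon_factorization w ws"
  by (rule ex_ex1I[OF is_nyldon_factorization_ex is_nyldon_factorization_unique])

lemma nyldon_factorization_eq_iff:
  "nyldon_factorization w = ws \<longleftrightarrow> is_nyldon_factorization w ws"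
proof
  assume "nyldon_factorization w = ws"
  then show "is_nyldon_factorization w ws"
    using theI'[OF ex1_is_nyldon_factorization[of w]] by (simp add: nyldon_factorization_def)
next
  assume "is_nyldon_factorization w ws"
  then show "nyldon_factorization w = ws"
    unfolding nyldon_factorization_def by (rule the1_equality[OF ex1_is_nyldon_factorization])
qed

end

theory Submission
  imports Defs
begin

text \<open>
  Call a set of Nyldon words \<^emph>\<open>balanced\<close> if no proper Nyldon suffix of a member exceeds any
  member; the set of all letters is balanced. If \<open>x\<close> is the least member and \<open>u > x\<close> another
  one, then \<open>u @ x\<close> is Nyldon and adding it keeps the set balanced (one step of Lazard
  elimination). Hence a product of members can be rewritten by merging \<open>u, x\<close> into \<open>u @ x\<close>,
  and leading occurrences of \<open>x\<close> are the first Nyldon factors.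

  With \<open>w = u @ v\<close> and \<open>n = v @ u\<close> we have \<open>w\<^sup>k = u @ n\<^sup>k\<^sup>-\<^sup>1 @ v\<close>. Start from single letters and
  perform the same merges in all copies of \<open>n\<close>. Since \<open>n\<close> is Nyldon, its current factorization
  never begins with the least member unless it is \<open>[n]\<close>, so no merge crosses the boundary
  between two copies; merges with the tail use up one copy at a time, and only finitely many.
  When \<open>n\<close> itself is the least member, nothing is left in front of the copies of \<open>n\<close>, because a
  Nyldon suffix of \<open>n\<close> is at most \<open>n\<close>; so all remaining copies are factors.
\<close>

section \<open>Balanced sets of Nyldon words\<close>

definition balanced :: "'a::linorder list set \<Rightarrow> bool" where
  "balanced S \<longleftrightarrow> (\<forall>u\<in>S. nyldon u) \<and>
     (\<forall>u\<in>S. \<forall>v\<in>S. \<forall>s. nyldon s \<longrightarrow> strict_suffix s u \<longrightarrow> s \<le> v)"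

lemma balanced_subset: "balanced S \<Longrightarrow> T \<subseteq> S \<Longrightarrow> balanced T"
  unfolding balanced_def by blast

lemma balanced_letters: "balanced (range (\<lambda>a. [a]))"
  unfolding balanced_def
proof (intro conjI ballI allI impI)
  fix u :: "'a list" assume "u \<in> range (\<lambda>a. [a])"
  then show "nyldon u" by (subst nyldon_iff) auto
next
  fix u v s :: "'a list"
  assume "u \<in> range (\<lambda>a. [a])" "nyldon s" "strict_suffix s u"
  then show "s \<le> v" using suffix_length_less[of s u] by auto
qed

section \<open>Products of two Nyldon words\<close>

lemma is_nyldon_factorization_snoc:
  assumes "is_nyldon_factorization w (ws @ [z])"
  shows "nyldon z" "w = concat ws @ z" "is_nyldon_factorization (concat ws) ws"
    "\<forall>y\<in>set ws. y \<le> z"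
  using assms by (auto simp: is_nyldon_factorization_def sorted_append)

text \<open>The last Nyldon factor of \<open>t\<close> is at most \<open>x\<close>, so appending
  \<open>x\<close> to the factors of \<open>t\<close> gives a sorted factorization with at least two
  members.\<close>

lemma not_nyldon_append:
  assumes "nyldon x" and t: "t \<noteq> []"
    and suf: "\<And>s. nyldon s \<Longrightarrow> suffix s t \<Longrightarrow> s \<le> x"
  shows "\<not> nyldon (t @ x)"
proof
  assume ny: "nyldon (t @ x)"
  obtain zs where zs: "is_nyldon_factorization t zs"
    using is_nyldon_factorization_ex by blast
  then have "zs \<noteq> []" using t by (auto simp: is_nyldon_factorization_def)
  then obtain ys z where zs_eq: "zs = ys @ [z]" by (metis append_butlast_last_id)
  note z = is_nyldon_factorization_snoc[OF zs[unfolded zs_eq]]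
  have "z \<le> x" using suf z(1,2) by (auto simp: suffix_def)
  then have "is_nyldon_factorization (t @ x) (zs @ [x])"
    using zs z(4) assms(1) by (force simp: is_nyldon_factorization_def sorted_append zs_eq)
  then show False using nyldon_factorization_singleton[OF ny] \<open>zs \<noteq> []\<close> by fastforce
qed

text \<open>A suffix longer than \<open>x\<close> is \<open>t @ x\<close> with \<open>t\<close> a
  nonempty suffix of \<open>u\<close>. If \<open>t\<close> is proper, its Nyldon suffixes are at
  most \<open>x\<close>, and \<open>not_nyldon_append\<close> rules it out.\<close>

lemma nyldon_suffix_append:
  assumes "nyldon x" "nyldon s" "suffix s (u @ x)"
    and suf: "\<And>s. nyldon s \<Longrightarrow> strict_suffix s u \<Longrightarrow> s \<le> x"
  shows "s = u @ x \<or> suffix s x"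
proof (rule ccontr)
  assume neg: "\<not> (s = u @ x \<or> suffix s x)"
  then obtain t where t: "s = t @ x" "suffix t u"
    using assms(3) unfolding suffix_append by blast
  have "t \<noteq> []" "t \<noteq> u" using neg t(1) by auto
  have "s' \<le> x" if "nyldon s'" "suffix s' t" for s'
  proof -
    have "strict_suffix s' u"
      using that(2) t(2) \<open>t \<noteq> u\<close> by (metis strict_suffix_def suffix_order.antisym suffix_order.trans)
    then show ?thesis using suf that(1) by blast
  qed
  then have "\<not> nyldon s"
    using not_nyldon_append[OF assms(1) \<open>t \<noteq> []\<close>] t(1) by blast
  then show False using assms(2) by simp
qed

text \<open>The last factor of \<open>u @ x\<close> ends in \<open>x\<close>, hence is
  \<open>u @ x\<close> or \<open>x\<close>. In the second case the other factors multiply to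
  \<open>u\<close>, so the factorization is \<open>[u, x]\<close>, which \<open>x < u\<close>
  forbids.\<close>

lemma nyldon_append:
  assumes "nyldon u" "nyldon x" "x < u"
    and suf: "\<And>s. nyldon s \<Longrightarrow> strict_suffix s u \<Longrightarrow> s \<le> x"
  shows "nyldon (u @ x)"
proof -
  obtain ws where ws: "is_nyldon_factorization (u @ x) ws"
    using is_nyldon_factorization_ex by blast
  have "ws \<noteq> [] \<and> suffix x (last ws)"
    using nyldon_suffix_aux[OF _ order_refl ws assms(2)] nyldon_suffix_less
    by (auto simp: suffix_def)
  then obtain ys z where ws_eq: "ws = ys @ [z]" and xz: "suffix x z"
    by (metis append_butlast_last_id last_snoc)
  note z = is_nyldon_factorization_snoc[OF ws[unfolded ws_eq]]
  have "suffix z (u @ x)" using z(2) by (auto simp: suffix_def)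
  then consider "z = u @ x" | "suffix z x"
    using nyldon_suffix_append[OF assms(2) z(1) _ suf] by blast
  then show ?thesis
  proof cases
    case 2
    then have "z = x" using xz by (simp add: suffix_order.antisym)
    then have "concat ys = u" using z(2) by simp
    then have "ys = [u]" using nyldon_factorization_singleton[OF assms(1)] z(3) by blast
    then show ?thesis using z(4) \<open>z = x\<close> assms(3) by simp
  qed (use z(1) in simp)
qed

text \<open>The proper Nyldon suffixes of \<open>u @ x\<close> are suffixes of \<open>x\<close>, and
  those of old members are at most \<open>x\<close>. As \<open>x < u < u @ x\<close>, the word
  \<open>x\<close> remains least, so it suffices to compare suffixes with \<open>x\<close>.\<close>

lemma balanced_merge:
  assumes S: "balanced S" and x: "x \<in> S" "\<And>v. v \<in> S \<Longrightarrow> x \<le> v" and u: "u \<in> S" "u \<noteq> x"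
  shows "balanced (insert (u @ x) S)"
proof -
  have ux: "nyldon u" "nyldon x" "x < u"
    using S x u by (auto simp: balanced_def less_le)
  have suf: "s \<le> x" if "nyldon s" "strict_suffix s v" "v \<in> S" for s v
    using S x(1) that unfolding balanced_def by blast
  have le: "x \<le> v" if "v \<in> insert (u @ x) S" for v
    using that x(2) ux(2,3) less_append_list[of x u] by force
  have "s \<le> x" if s: "nyldon s" "strict_suffix s v" and v: "v \<in> insert (u @ x) S" for s v
  proof (cases "v \<in> S")
    case True
    then show ?thesis using suf s by blast
  next
    case False
    then have v_eq: "v = u @ x" using v by simp
    then have "suffix s x"
      using nyldon_suffix_append[OF ux(2) s(1), of u] suf u(1) s(2)
      by (auto simp: strict_suffix_def)
    then show ?thesis using suf[OF s(1) _ x(1)] by (cases "s = x") (auto simp: strict_suffix_def)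
  qed
  moreover have "nyldon v" if "v \<in> insert (u @ x) S" for v
    using that S nyldon_append[OF ux] suf u(1) unfolding balanced_def by blast
  ultimately show ?thesis using le unfolding balanced_def by (meson order_trans)
qed

section \<open>Factorizing products over a balanced set\<close>

lemma split_first_predecessor:
  assumes "x \<in> set xs" "hd xs \<noteq> x"
  obtains ys u zs where "xs = ys @ u # x # zs" "u \<noteq> x"
proof -
  obtain ys zs where 1: "xs = ys @ x # zs" "x \<notin> set ys"
    using split_list_first[OF assms(1)] by blast
  then have "ys \<noteq> []" using assms(2) by auto
  then obtain ys' u where "ys = ys' @ [u]" by (metis append_butlast_last_id)
  with 1 that[of ys' u zs] show ?thesis by auto
qed

text \<open>Each step shortens \<open>xs\<close>: if the least block \<open>m\<close> comes first,
  it is split off as a factor; otherwise the leftmost \<open>m\<close> is merged into its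
  predecessor, which leaves the product unchanged.\<close>

lemma factors_of_balanced_concat_ge:
  assumes "balanced (set xs)" "\<And>v. v \<in> set xs \<Longrightarrow> x \<le> v" "is_nyldon_factorization (concat xs) ws"
  shows "\<forall>z\<in>set ws. x \<le> z"
  using assms
proof (induction "length xs" arbitrary: xs x ws rule: less_induct)
  case (less xs)
  show ?case
  proof (cases "xs = []")
    case True
    then show ?thesis using less.prems(3) by (cases ws) (auto simp: is_nyldon_factorization_def)
  next
    case ne: False
    define m where "m = Min (set xs)"
    have m: "m \<in> set xs" "\<And>v. v \<in> set xs \<Longrightarrow> m \<le> v"
      using ne by (auto simp: m_def)
    have "x \<le> m" using less.prems(2) m(1) by blast
    show ?thesis
    proof (cases "hd xs = m")
      case True
      then obtain xs' where xs: "xs = m # xs'" using ne by (cases xs) auto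
      obtain ws' where ws': "is_nyldon_factorization (concat xs') ws'"
        using is_nyldon_factorization_ex by blast
      \<comment> \<open>The induction hypothesis is used with the bound \<open>m\<close> instead of
        \<open>x\<close>, so that \<open>m # ws'\<close> is sorted.\<close>
      have ge: "\<forall>z\<in>set ws'. m \<le> z"
        by (rule less.hyps[OF _ _ _ ws'])
           (use xs m less.prems(1) in \<open>auto intro: balanced_subset\<close>)
      have "nyldon m" using m(1) less.prems(1) by (auto simp: balanced_def)
      then have "is_nyldon_factorization (concat xs) (m # ws')"
        using ws' ge xs by (auto simp: is_nyldon_factorization_def)
      then have "ws = m # ws'" using less.prems(3) is_nyldon_factorization_unique by blast
      then show ?thesis using ge \<open>x \<le> m\<close> by auto
    next
      case False
      obtain ys u zs where xs: "xs = ys @ u # m # zs" "u \<noteq> m"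
        using split_first_predecessor[OF m(1) False] by blast
      let ?xs = "ys @ (u @ m) # zs"
      have "m \<noteq> []" using m(1) less.prems(1) by (auto simp: balanced_def)
      have "balanced (insert (u @ m) (set xs))"
        using balanced_merge[OF less.prems(1) m, of u] xs by auto
      then have "balanced (set ?xs)" by (rule balanced_subset) (auto simp: xs)
      moreover have "x \<le> v" if "v \<in> set ?xs" for v
        using that less.prems(2) xs less_append_list[OF \<open>m \<noteq> []\<close>, of u] by force
      moreover have "is_nyldon_factorization (concat ?xs) ws" using less.prems(3) xs by simp
      ultimately show ?thesis using less.hyps[of ?xs x ws] xs by simp
    qed
  qed
qed

lemma is_nyldon_factorization_least_Cons:
  assumes "balanced (set xs)" "nyldon x" "\<And>v. v \<in> set xs \<Longrightarrow> x \<le> v"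
    "is_nyldon_factorization (concat xs) ws"
  shows "is_nyldon_factorization (x @ concat xs) (x # ws)"
  using factors_of_balanced_concat_ge[OF assms(1,3,4)] assms(2,4)
  by (auto simp: is_nyldon_factorization_def)

lemma nyldon_hd_not_least:
  assumes "balanced (set (x # xs))" "\<And>v. v \<in> set xs \<Longrightarrow> x \<le> v" "nyldon (concat (x # xs))"
  shows "xs = []"
proof -
  obtain ws where ws: "is_nyldon_factorization (concat xs) ws"
    using is_nyldon_factorization_ex by blast
  have "nyldon x" "balanced (set xs)"
    using assms(1) by (auto simp: balanced_def)
  then have "is_nyldon_factorization (concat (x # xs)) (x # ws)"
    using is_nyldon_factorization_least_Cons assms(2) ws by auto
  then have "x # ws = [concat (x # xs)]"
    using nyldon_factorization_singleton[OF assms(3)] by blast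
  then have "concat xs = []" by simp
  moreover have "[] \<notin> set xs" using assms(1) by (auto simp: balanced_def)
  ultimately show ?thesis by (cases xs) auto
qed

section \<open>Runs of a repeated factor\<close>

text \<open>The loss \<open>K\<close> is uniform in \<open>k\<close>, while \<open>ps\<close> and
  \<open>ss\<close> may vary with it. The guard keeps the natural subtraction exact.\<close>

definition has_run :: "'a::linorder list \<Rightarrow> 'a list \<Rightarrow> 'a list \<Rightarrow> bool" where
  "has_run n p q \<longleftrightarrow> (\<exists>K. \<forall>k\<ge>K. \<exists>ps ss.
     is_nyldon_factorization (p @ word_power n k @ q) (ps @ replicate (k - K) n @ ss))"

lemma word_power_Suc_right: "word_power w (Suc k) = word_power w k @ w"
  by (simp flip: replicate_append_same)

text \<open>One copy of \<open>n\<close> is handed over to the tail, which raises the loss from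
  \<open>K\<close> to \<open>Suc K\<close>.\<close>

lemma has_run_absorb:
  assumes "has_run n p (n @ q)"
  shows "has_run n p q"
proof -
  obtain K where K: "\<And>k. k \<ge> K \<Longrightarrow> \<exists>ps ss.
     is_nyldon_factorization (p @ word_power n k @ n @ q) (ps @ replicate (k - K) n @ ss)"
    using assms unfolding has_run_def by blast
  have "\<exists>ps ss. is_nyldon_factorization (p @ word_power n k @ q) (ps @ replicate (k - Suc K) n @ ss)"
    if "k \<ge> Suc K" for k
  proof -
    obtain j where j: "k = Suc j" "j \<ge> K" using \<open>k \<ge> Suc K\<close> by (cases k) auto
    then show ?thesis using K[OF j(2)] by (simp add: word_power_Suc_right del: replicate_Suc)
  qed
  then show ?thesis unfolding has_run_def by blast
qed

lemma concat_concat_replicate: "concat (concat (replicate k xs)) = word_power (concat xs) k"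
  by (induction k) auto

lemma set_concat_replicate_subset: "set (concat (replicate k xs)) \<subseteq> set xs"
  by (induction k) auto

text \<open>The blocks of the whole product come from the same balanced set for every
  \<open>k\<close>, so \<open>x\<close> is always its first factor and joins \<open>ps\<close>
  without changing \<open>K\<close>.\<close>

lemma has_run_strip:
  assumes "balanced (set (x # P @ N @ Q))" "\<And>v. v \<in> set (P @ N @ Q) \<Longrightarrow> x \<le> v"
    and run: "has_run (concat N) (concat P) (concat Q)"
  shows "has_run (concat N) (concat (x # P)) (concat Q)"
proof -
  obtain K where K: "\<And>k. k \<ge> K \<Longrightarrow> \<exists>ps ss. is_nyldon_factorization
     (concat P @ word_power (concat N) k @ concat Q) (ps @ replicate (k - K) (concat N) @ ss)"
    using run unfolding has_run_def by blast
  have "\<exists>ps ss. is_nyldon_factorization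
     (concat (x # P) @ word_power (concat N) k @ concat Q) (ps @ replicate (k - K) (concat N) @ ss)"
    if "k \<ge> K" for k
  proof -
    let ?L = "P @ concat (replicate k N) @ Q"
    have sub: "set ?L \<subseteq> set (P @ N @ Q)"
      using set_concat_replicate_subset[of k N] by auto
    have "balanced (set ?L)"
      by (rule balanced_subset[OF assms(1)]) (use sub in auto)
    moreover have "nyldon x" using assms(1) by (auto simp: balanced_def)
    moreover obtain ps ss where "is_nyldon_factorization
       (concat ?L) (ps @ replicate (k - K) (concat N) @ ss)"
      using K[OF \<open>k \<ge> K\<close>] by (auto simp: concat_concat_replicate)
    ultimately have "is_nyldon_factorization (x @ concat ?L)
       (x # ps @ replicate (k - K) (concat N) @ ss)"
      using is_nyldon_factorization_least_Cons[of ?L x] assms(2) sub by blast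
    then have "is_nyldon_factorization (concat (x # P) @ word_power (concat N) k @ concat Q)
       ((x # ps) @ replicate (k - K) (concat N) @ ss)"
      by (simp add: concat_concat_replicate)
    then show ?thesis by blast
  qed
  then show ?thesis unfolding has_run_def by blast
qed

lemma has_run_least:
  assumes "balanced (insert n (set Q))" "\<And>v. v \<in> set Q \<Longrightarrow> n \<le> v"
  shows "has_run n [] (concat Q)"
proof -
  obtain ws where ws: "is_nyldon_factorization (concat Q) ws"
    using is_nyldon_factorization_ex by blast
  have "balanced (set Q)" "nyldon n"
    using assms(1) by (auto simp: balanced_def)
  have ge: "\<forall>z\<in>set ws. n \<le> z"
    using factors_of_balanced_concat_ge[OF \<open>balanced (set Q)\<close> assms(2) ws] .
  have "is_nyldon_factorization (word_power n k @ concat Q) (replicate k n @ ws)" for k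
    by (induction k) (use ws ge \<open>nyldon n\<close> in \<open>auto simp: is_nyldon_factorization_def\<close>)
  then have "\<forall>k\<ge>0. \<exists>ps ss. is_nyldon_factorization ([] @ word_power n k @ concat Q)
      (ps @ replicate (k - 0) n @ ss)"
    by (metis append_Nil diff_zero)
  then show ?thesis unfolding has_run_def by blast
qed

section \<open>Simultaneous elimination in all copies\<close>

lemma has_run_balanced:
  assumes "balanced (set (P @ N @ Q))" "N \<noteq> []" "nyldon (concat N)" "suffix (concat P) (concat N)"
  shows "has_run (concat N) (concat P) (concat Q)"
  using assms
\<comment> \<open>Absorbing a copy of \<open>N\<close> may lengthen \<open>Q\<close>, so its length
  cannot serve as a measure. Only the blocks of \<open>Q\<close> below every block of
  \<open>N\<close> are counted: these are the ones still to be eliminated from the tail.\<close>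
proof (induction "(length N, length P, length (filter (\<lambda>q. q < Min (set N)) Q))"
    arbitrary: P N Q
    rule: wf_induct_rule[OF wf_lex_prod[OF wf_less_than wf_lex_prod[OF wf_less_than wf_less_than]]])
  case (1 P N Q)
  note IH = 1(1)[simplified]
  note bal = "1.prems"(1) and ne = "1.prems"(2) and ny = "1.prems"(3) and suf = "1.prems"(4)
  let ?S = "set (P @ N @ Q)"
  define x where "x = Min ?S"
  have "Min ?S \<in> ?S" by (rule Min_in) (use ne in auto)
  then have x: "x \<in> ?S" "\<And>v. v \<in> ?S \<Longrightarrow> x \<le> v"
    by (auto simp: x_def)
  have "x \<noteq> []" using x(1) bal not_nyldon_Nil unfolding balanced_def by metis
  have merge: "balanced (insert (u @ x) ?S)" if "u \<in> ?S" "u \<noteq> x" for u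
    using balanced_merge[OF bal x that] .
  consider (P) "x \<in> set P" | (N) "x \<notin> set P" "x \<in> set N"
    | (Q) "x \<notin> set N" "x \<in> set Q"
    using x(1) by auto
  then show ?case
  proof cases
    case P
    show ?thesis
    proof (cases "hd P = x")
      case True
      then obtain P' where P': "P = x # P'" using P by (cases P) auto
      have "has_run (concat N) (concat P') (concat Q)"
      proof (rule IH)
        show "balanced (set P' \<union> (set N \<union> set Q))"
          by (rule balanced_subset[OF bal]) (auto simp: P')
        show "suffix (concat P') (concat N)"
          using suf P' by (auto simp: suffix_def)
      qed (use P' ne ny in auto)
      then show ?thesis
        unfolding P' by (intro has_run_strip) (use bal x P' in auto)
    next
      case False
      obtain ys u zs where P': "P = ys @ u # x # zs" "u \<noteq> x"
        using split_first_predecessor[OF P False] by blast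
      have "has_run (concat N) (concat (ys @ (u @ x) # zs)) (concat Q)"
      proof (rule IH)
        show "balanced (set (ys @ (u @ x) # zs) \<union> (set N \<union> set Q))"
          by (rule balanced_subset[OF merge[of u]]) (auto simp: P')
        show "suffix (concat (ys @ (u @ x) # zs)) (concat N)"
          using suf P' by simp
      qed (use P' ne ny in auto)
      then show ?thesis using P' by simp
    qed
  next
    case N
    show ?thesis
    proof (cases "hd N = x")
      case True
      then obtain N' where N': "N = x # N'" using ne by (cases N) auto
      have "N' = []"
        by (rule nyldon_hd_not_least[of x])
           (use N' ny x in \<open>auto intro: balanced_subset[OF bal]\<close>)
      then have n: "N = [x]" using N' by simp
      \<comment> \<open>The last block of \<open>P\<close> would be a Nyldon suffix of
        \<open>x\<close>, proper because \<open>x\<close> does not occur in \<open>P\<close>, hence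
        smaller than the least block.\<close>
      have "P = []"
      proof (rule ccontr)
        assume "P \<noteq> []"
        then obtain P' u where P': "P = P' @ [u]" by (metis append_butlast_last_id)
        have "nyldon u" using bal P' by (auto simp: balanced_def)
        moreover have "suffix u x" using suf n P' by (auto simp: suffix_def)
        moreover have "u \<noteq> x" using N(1) P' by auto
        ultimately have "u < x" using nyldon_suffix_less[of x u] ny n by (auto simp: strict_suffix_def)
        moreover have "x \<le> u" using x(2) P' by simp
        ultimately show False by simp
      qed
      then show ?thesis using has_run_least[of x Q] bal x n by simp
    next
      case False
      obtain ys u zs where N': "N = ys @ u # x # zs" "u \<noteq> x"
        using split_first_predecessor[OF N(2) False] by blast
      let ?N = "ys @ (u @ x) # zs"
      have eq: "concat ?N = concat N" using N' by simp
      \<comment> \<open>One merge in the list \<open>N\<close> stands for the same merge in every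
        copy. The third component of the measure may grow, but the first one drops.\<close>
      have "has_run (concat ?N) (concat P) (concat Q)"
      proof (rule IH)
        show "balanced (set P \<union> (set ?N \<union> set Q))"
          by (rule balanced_subset[OF merge[of u]]) (auto simp: N')
      qed (use N' ny suf in auto)
      then show ?thesis using eq by simp
    qed
  next
    case Q
    have less: "x < Min (set N)"
      using ne Q(1) x(2) by (metis Min_in List.finite_set Un_iff set_append set_empty order.not_eq_order_implies_strict)
    show ?thesis
    proof (cases "hd Q = x")
      case True
      then obtain Q' where Q': "Q = x # Q'" using Q(2) by (cases Q) auto
      obtain N' u where N': "N = N' @ [u]" using ne by (metis append_butlast_last_id)
      \<comment> \<open>The last copy of \<open>N\<close> moves into the tail, where its last block
        \<open>u\<close> absorbs \<open>x\<close>. The moved blocks, including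
        \<open>u @ x > u\<close>, are not below \<open>Min (set N)\<close>, so the count loses
        \<open>x\<close> and gains nothing.\<close>
      let ?Q = "N' @ (u @ x) # Q'"
      have "\<forall>v\<in>set N. Min (set N) \<le> v" by simp
      then have large: "filter (\<lambda>q. q < Min (set N)) N' = []" "\<not> u @ x < Min (set N)"
        using less_append_list[OF \<open>x \<noteq> []\<close>, of u] unfolding N' by (auto simp: filter_empty_conv not_less)
      have "has_run (concat N) (concat P) (concat ?Q)"
      proof (rule IH)
        show "balanced (set P \<union> (set N \<union> set ?Q))"
          by (rule balanced_subset[OF merge[of u]]) (use N' Q' Q(1) in auto)
      qed (use ne ny suf less large Q' in auto)
      then show ?thesis using has_run_absorb[of "concat N" "concat P" "concat Q"] N' Q' by simp
    next
      case False
      obtain ys u zs where Q': "Q = ys @ u # x # zs" "u \<noteq> x"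
        using split_first_predecessor[OF Q(2) False] by blast
      let ?Q = "ys @ (u @ x) # zs"
      \<comment> \<open>Hence \<open>u @ x\<close> is counted only if \<open>u\<close> was, and the
        count drops by at least the removed \<open>x\<close>.\<close>
      have "u < u @ x" using less_append_list[OF \<open>x \<noteq> []\<close>] .
      have "has_run (concat N) (concat P) (concat ?Q)"
      proof (rule IH)
        show "balanced (set P \<union> (set N \<union> set ?Q))"
          by (rule balanced_subset[OF merge[of u]]) (auto simp: Q')
      qed (use Q' ne ny suf less \<open>u < u @ x\<close> in auto)
      then show ?thesis using Q' by simp
    qed
  qed
qed

section \<open>From powers of \<open>n\<close> to powers of \<open>w\<close>\<close>

lemma word_power_conjugate: "word_power (u @ v) (Suc k) = u @ word_power (v @ u) k @ v"
  by (induction k) auto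

theorem theorem4p3:
  fixes m :: nat and w n :: "nat list"
  assumes "m \<ge> 1"
    and "w \<noteq> []" and "set w \<subseteq> {0..m}"
    and "primitive w"
    and "nyldon n" and "conjugate n w"
  shows "\<exists>(K::int) (k0::int). \<forall>k::nat. int k \<ge> k0 \<longrightarrow>
    (\<exists>ps ss r. (\<forall>p\<in>set ps. nyldon p) \<and> (\<forall>s\<in>set ss. nyldon s) \<and>
       int r = int k - K \<and>
       nyldon_factorization (word_power w k) = ps @ replicate r n @ ss)"
proof -
  obtain u v where w: "w = u @ v" and n: "n = v @ u"
    using assms(6) unfolding conjugate_def by blast
  let ?l = "map (\<lambda>a::nat. [a])"
  \<comment> \<open>The elimination starts from single letters; \<open>n = v @ u\<close> supplies
    the required suffix relation between \<open>u\<close> and \<open>n\<close>.\<close>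
  have "has_run (concat (?l n)) (concat (?l u)) (concat (?l v))"
  proof (rule has_run_balanced)
    show "balanced (set (?l u @ ?l n @ ?l v))"
      by (rule balanced_subset[OF balanced_letters]) auto
    show "?l n \<noteq> []" using assms(5) by auto
  qed (use assms(5) n in \<open>auto simp: suffix_def\<close>)
  then obtain K where K: "\<And>k. k \<ge> K \<Longrightarrow> \<exists>ps ss.
      is_nyldon_factorization (u @ word_power n k @ v) (ps @ replicate (k - K) n @ ss)"
    unfolding has_run_def by auto
  \<comment> \<open>The loss is \<open>Suc K\<close> because one of the \<open>k\<close> copies of
    \<open>w\<close> is spent on the outer pieces \<open>u\<close> and \<open>v\<close>.\<close>
  have "\<exists>ps ss r. (\<forall>p\<in>set ps. nyldon p) \<and> (\<forall>s\<in>set ss. nyldon s) \<and> int r = int k - int (Suc K) \<and>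
       nyldon_factorization (word_power w k) = ps @ replicate r n @ ss"
    if "int k \<ge> int (Suc K)" for k
  proof -
    obtain j where j: "k = Suc j" "j \<ge> K" using \<open>int k \<ge> int (Suc K)\<close> by (cases k) auto
    obtain ps ss where f: "is_nyldon_factorization (word_power w k) (ps @ replicate (j - K) n @ ss)"
      using K[OF j(2)] by (metis word_power_conjugate j(1) w n)
    have "\<forall>p\<in>set ps. nyldon p" "\<forall>s\<in>set ss. nyldon s"
      using f by (auto simp: is_nyldon_factorization_def)
    moreover have "int (j - K) = int k - int (Suc K)" using j by simp
    ultimately show ?thesis using f nyldon_factorization_eq_iff by blast
  qed
  then show ?thesis by blast
qed

end
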